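(* The equation $(13^{n}-1)(76^{n}-1)=x^{2}$ in positive integers $n,x$ has only the solution $n=1$, $x=30$. *)

theory Defs
  imports Complex_Main "HOL-Number_Theory.Number_Theory"
begin

end

theory Submission
  imports Defs "HOL-Computational_Algebra.Nth_Powers"
begin

text \<open>
  The argument splits by the parity of \<open>n\<close>.

  For odd \<open>n > 1\<close> the equation fails by congruences. The factor \<open>76 ^ n\<close> vanishes modulo \<open>32\<close>, so
  \<open>1 - 13 ^ n\<close> is a square modulo \<open>32\<close>, and this leaves only \<open>n \<equiv> 5 (mod 8)\<close>. Both bases have
  order dividing \<open>8\<close> modulo \<open>17\<close>, so \<open>x\<^sup>2\<close> is then a fixed residue modulo \<open>17\<close>, namely the
  non-residue \<open>11\<close>.

  For \<open>n = 2 m\<close> put \<open>A = 13 ^ m\<close> and \<open>B = 76 ^ m\<close>. Two positive integers whose product is a square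
  become squares after division by their greatest common divisor \<open>d\<close>, so
  \<open>A\<^sup>2 - d u\<^sup>2 = 1 = B\<^sup>2 - d v\<^sup>2\<close> for some \<open>u\<close> and \<open>v\<close>. Thus \<open>A\<close> and \<open>B\<close> are first coordinates in one group of Pell solutions. Since this group is cyclic up to
  sign and contains the even \<open>B\<close>, its fundamental solution has an even first coordinate, and the odd
  first coordinates are those of the even powers, that is, of squares of solutions:
  \<open>A = 2 z\<^sup>2 - 1\<close> for some \<open>z\<close> (\<open>pell_odd_imp_square\<close>). But \<open>13\<close> divides \<open>A\<close>, so \<open>2 z\<^sup>2 \<equiv> 1 (mod 13)\<close>,
  which is impossible because \<open>2\<close> is not a square modulo \<open>13\<close>.

  Cyclicity of the group is not proved separately: the statement about \<open>A\<close> and \<open>B\<close> comes directly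
  from a Euclidean descent on the pair.
\<close>

section \<open>Pell solutions with first coordinates of opposite parity\<close>

text \<open>
  The next two lemmas are the two reductions of the descent. Writing \<open>\<alpha> = A + u \<surd>d\<close> and
  \<open>\<beta> = B + v \<surd>d\<close>, they pass to the first coordinate of \<open>\<alpha> / \<beta>\<close> and of \<open>\<alpha> / \<beta>\<^sup>2\<close>.
  On the logarithmic scale these are \<open>\<bar>log \<alpha> - log \<beta>\<bar>\<close> and \<open>\<bar>log \<alpha> - 2 log \<beta>\<bar>\<close>, which explains
  the size conditions.
\<close>

lemma pell_quotient:
  fixes A B d u v :: int
  assumes A: "A\<^sup>2 = d * u\<^sup>2 + 1" "A > 1" and B: "B\<^sup>2 = d * v\<^sup>2 + 1" "B > A"
    and "d > 0" "u * v \<ge> 0"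
  shows "(A * B - d * u * v)\<^sup>2 = d * (B * u - A * v)\<^sup>2 + 1"
    and "A * B - d * u * v > 0" and "A * B - d * u * v < B"
proof -
  have "(A * B - d * u * v)\<^sup>2 - d * (B * u - A * v)\<^sup>2 = (A\<^sup>2 - d * u\<^sup>2) * (B\<^sup>2 - d * v\<^sup>2)"
    by (simp add: power2_eq_square algebra_simps)
  then show "(A * B - d * u * v)\<^sup>2 = d * (B * u - A * v)\<^sup>2 + 1"
    using A B by simp
  have duv: "(d * u * v)\<^sup>2 = (A\<^sup>2 - 1) * (B\<^sup>2 - 1)"
    using A(1) B(1) by (simp add: power_mult_distrib power2_eq_square)
  have "A\<^sup>2 > 0" "B\<^sup>2 > 0"
    by (rule zero_less_power, use A(2) B(2) in linarith)+
  moreover have "(d * u * v)\<^sup>2 = (A * B)\<^sup>2 - (A\<^sup>2 + B\<^sup>2 - 1)"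
    unfolding duv by (simp add: power_mult_distrib algebra_simps)
  ultimately have "(d * u * v)\<^sup>2 < (A * B)\<^sup>2" by linarith
  then show "A * B - d * u * v > 0"
    using power_less_imp_less_base[of "d * u * v" 2 "A * B"] A B by simp
  have "A * 1 < B * B" using A B by (intro mult_strict_mono) auto
  moreover have "B * 1 < B * B" using A B by (intro mult_strict_left_mono) auto
  ultimately have "0 < 2 * B\<^sup>2 - A - 1"
    using A(2) B(2) unfolding power2_eq_square by linarith
  then have "0 < (A - 1) * (2 * B\<^sup>2 - A - 1)"
    using A(2) by simp
  also have "\<dots> = (A\<^sup>2 - 1) * (B\<^sup>2 - 1) - (B * (A - 1))\<^sup>2"
    by (simp add: power2_eq_square algebra_simps)
  finally have "(B * (A - 1))\<^sup>2 < (d * u * v)\<^sup>2"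
    unfolding duv by simp
  moreover have "d * u * v \<ge> 0"
    using \<open>d > 0\<close> \<open>u * v \<ge> 0\<close> by (simp add: mult.assoc)
  ultimately have "B * (A - 1) < d * u * v"
    using power_less_imp_less_base[of "B * (A - 1)" 2 "d * u * v"] by simp
  then show "A * B - d * u * v < B"
    by (simp add: algebra_simps)
qed

lemma pell_quotient_square:
  fixes A B d u v :: int
  assumes A: "A\<^sup>2 = d * u\<^sup>2 + 1" "A > B" and B: "B\<^sup>2 = d * v\<^sup>2 + 1" "B > 1"
    and "d > 0" "u * v \<ge> 0"
  defines "A' \<equiv> A * (2 * B\<^sup>2 - 1) - 2 * d * u * B * v"
    and "u' \<equiv> u * (2 * B\<^sup>2 - 1) - 2 * A * B * v"
  shows "A'\<^sup>2 = d * u'\<^sup>2 + 1" and "A' > 0" and "A' < A"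
proof -
  define T S where "T = 2 * B\<^sup>2 - 1" and "S = 2 * B * v"
  have "T\<^sup>2 - (d * S\<^sup>2 + 1) = 4 * B\<^sup>2 * (B\<^sup>2 - (d * v\<^sup>2 + 1))"
    unfolding T_def S_def by (simp add: power2_eq_square algebra_simps)
  then have T: "T\<^sup>2 = d * S\<^sup>2 + 1"
    using B(1) by simp
  have A': "A' = A * T - d * u * S" "u' = u * T - A * S"
    by (simp_all add: A'_def u'_def T_def S_def algebra_simps)
  have "A'\<^sup>2 - d * u'\<^sup>2 = (A\<^sup>2 - d * u\<^sup>2) * (T\<^sup>2 - d * S\<^sup>2)"
    unfolding A' by (simp add: power2_eq_square algebra_simps)
  then show "A'\<^sup>2 = d * u'\<^sup>2 + 1"
    using A T by simp
  have "B\<^sup>2 \<ge> 1" by (rule one_le_power) (use B(2) in linarith)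
  then have "T > 0" by (simp add: T_def)
  have duS: "(d * u * S)\<^sup>2 = (A\<^sup>2 - 1) * (T\<^sup>2 - 1)"
    using A(1) T by (simp add: power_mult_distrib power2_eq_square)
  have "A\<^sup>2 > 0" "T\<^sup>2 > 0"
    by (rule zero_less_power, use A(2) B(2) \<open>T > 0\<close> in linarith)+
  moreover have "(d * u * S)\<^sup>2 = (A * T)\<^sup>2 - (A\<^sup>2 + T\<^sup>2 - 1)"
    unfolding duS by (simp add: power_mult_distrib algebra_simps)
  ultimately have "(d * u * S)\<^sup>2 < (A * T)\<^sup>2" by linarith
  then show "A' > 0"
    using power_less_imp_less_base[of "d * u * S" 2 "A * T"] A B \<open>T > 0\<close> by (simp add: A')
  \<comment> \<open>Since \<open>B\<^sup>2 - 1 = d v\<^sup>2\<close>, the claim \<open>A' < A\<close> says \<open>A (B\<^sup>2 - 1) < d u B v\<close>.\<close>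
  have "B\<^sup>2 < A\<^sup>2" using A B by (intro power_strict_mono) auto
  moreover have "B\<^sup>2 > 1" using B(2) by (simp add: one_less_power)
  ultimately have "0 < (B\<^sup>2 - 1) * (A\<^sup>2 - B\<^sup>2)" by simp
  also have "\<dots> = (A\<^sup>2 - 1) * (B\<^sup>2 - 1) * B\<^sup>2 - (A * (B\<^sup>2 - 1))\<^sup>2"
    by (simp add: power2_eq_square algebra_simps)
  also have "(A\<^sup>2 - 1) * (B\<^sup>2 - 1) * B\<^sup>2 = (d * u * B * v)\<^sup>2"
    using A(1) B(1) by (simp add: power_mult_distrib power2_eq_square)
  finally have "(A * (B\<^sup>2 - 1))\<^sup>2 < (d * u * B * v)\<^sup>2" by simp
  moreover have "d * (u * v) * B \<ge> 0"
    using \<open>d > 0\<close> \<open>u * v \<ge> 0\<close> B(2) by simp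
  then have "d * u * B * v \<ge> 0" by (simp add: algebra_simps)
  ultimately have "A * (B\<^sup>2 - 1) < d * u * B * v"
    using power_less_imp_less_base[of "A * (B\<^sup>2 - 1)" 2 "d * u * B * v"] by simp
  then show "A' < A"
    by (simp add: A'_def algebra_simps)
qed

text \<open>
  The Euclidean algorithm on the exponents of two Pell solutions. Dividing \<open>\<beta>\<close> by \<open>\<alpha>\<close> keeps \<open>B\<close>
  even, and dividing \<open>\<alpha>\<close> by \<open>\<beta>\<^sup>2\<close> keeps \<open>A\<close> odd and changes \<open>\<alpha>\<close> by the square of a solution, so
  the descent ends at the trivial solution \<open>A = 1\<close>. The second coordinates range over all integers
  because the quotients do not come with a definite sign. The conclusion carries the whole identity
  \<open>\<alpha> = (z + w \<surd>d)\<^sup>2\<close>, since the first coordinate alone would not survive multiplication by \<open>\<beta>\<^sup>2\<close>.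
\<close>

lemma pell_odd_imp_square:
  fixes A B d u v :: int
  assumes "A\<^sup>2 = d * u\<^sup>2 + 1" "B\<^sup>2 = d * v\<^sup>2 + 1" "d > 0" "A > 0" "B > 0" "odd A" "even B"
  shows "\<exists>z w. z\<^sup>2 = d * w\<^sup>2 + 1 \<and> A = 2 * z\<^sup>2 - 1 \<and> u = 2 * z * w"
  using assms
proof (induction "nat (A + B)" arbitrary: A B u v rule: less_induct)
  case less
  \<comment> \<open>Conjugating \<open>\<beta>\<close> if necessary gives both second coordinates the same sign, so that the
     products with conjugates below are the quotients of smaller size.\<close>
  obtain v' where v': "B\<^sup>2 = d * v'\<^sup>2 + 1" "u * v' \<ge> 0"
  proof (cases "u * v \<ge> 0")
    case True
    then show ?thesis using that less.prems by blast
  next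
    case False
    then show ?thesis using that[of "- v"] less.prems by simp
  qed
  have "B > 1" using \<open>even B\<close> \<open>B > 0\<close> by (cases "B = 1") auto
  \<comment> \<open>The parity of \<open>u\<close>, forced through \<open>d\<close> by the even solution, is what makes the first coordinate
     of \<open>\<alpha> / \<beta>\<close> even.\<close>
  have "odd (d * v'\<^sup>2)"
    using v'(1) \<open>even B\<close> by (metis even_add even_power odd_one zero_less_numeral)
  then have "odd d" by simp
  have "even (d * u\<^sup>2)"
    using less.prems(1) \<open>odd A\<close> by (metis even_add even_power odd_one)
  then have "even u" using \<open>odd d\<close> by simp
  consider "A = 1" | "A > 1" "A < B" | "B < A"
    using \<open>A > 0\<close> \<open>odd A\<close> \<open>even B\<close> by (cases "A = B"; force)
  then show ?case
  proof cases
    case 1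
    then have "u = 0" using less.prems by simp
    with 1 show ?thesis by (intro exI[of _ 1] exI[of _ 0]) simp
  next
    case 2
    note q = pell_quotient[OF less.prems(1) 2(1) v'(1) 2(2) \<open>d > 0\<close> v'(2)]
    have "even (A * B - d * u * v')"
      using \<open>even B\<close> \<open>even u\<close> by simp
    with q show ?thesis
      using less.hyps[OF _ less.prems(1) q(1)] less.prems by simp
  next
    case 3
    define A' u' where "A' = A * (2 * B\<^sup>2 - 1) - 2 * d * u * B * v'"
      and "u' = u * (2 * B\<^sup>2 - 1) - 2 * A * B * v'"
    note q = pell_quotient_square[OF less.prems(1) 3 v'(1) \<open>B > 1\<close> \<open>d > 0\<close> v'(2),
        folded A'_def u'_def]
    have "odd A'" using \<open>odd A\<close> by (simp add: A'_def)
    with q obtain z w where zw: "z\<^sup>2 = d * w\<^sup>2 + 1" "A' = 2 * z\<^sup>2 - 1" "u' = 2 * z * w"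
      using less.hyps[OF _ q(1) less.prems(2)] less.prems by auto
    \<comment> \<open>Multiplying back by \<open>\<beta>\<^sup>2\<close>: if \<open>\<alpha> / \<beta>\<^sup>2\<close> is the square of \<open>z + w \<surd>d\<close>, then \<open>\<alpha>\<close> is the square
       of \<open>(z + w \<surd>d) \<beta>\<close>.\<close>
    have "A' * (2 * B\<^sup>2 - 1) + 2 * d * u' * B * v' - A = 4 * A * B\<^sup>2 * (B\<^sup>2 - (d * v'\<^sup>2 + 1))"
      unfolding A'_def u'_def by (simp add: power2_eq_square algebra_simps)
    then have A: "A = A' * (2 * B\<^sup>2 - 1) + 2 * d * u' * B * v'"
      using v'(1) by simp
    have "u' * (2 * B\<^sup>2 - 1) + 2 * A' * B * v' - u = 4 * u * B\<^sup>2 * (B\<^sup>2 - (d * v'\<^sup>2 + 1))"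
      unfolding A'_def u'_def by (simp add: power2_eq_square algebra_simps)
    then have u: "u = u' * (2 * B\<^sup>2 - 1) + 2 * A' * B * v'"
      using v'(1) by simp
    let ?z = "z * B + d * w * v'" and ?w = "z * v' + w * B"
    have "?z\<^sup>2 - d * ?w\<^sup>2 = (z\<^sup>2 - d * w\<^sup>2) * (B\<^sup>2 - d * v'\<^sup>2)"
      by (simp add: power2_eq_square algebra_simps)
    then have "?z\<^sup>2 = d * ?w\<^sup>2 + 1"
      using zw(1) v'(1) by simp
    moreover
    have dw: "d * w\<^sup>2 = z\<^sup>2 - 1" and dv: "d * v'\<^sup>2 = B\<^sup>2 - 1"
      using zw(1) v'(1) by simp_all
    have "?z\<^sup>2 = z\<^sup>2 * B\<^sup>2 + 2 * d * z * w * B * v' + (d * w\<^sup>2) * (d * v'\<^sup>2)"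
      by (simp add: power2_eq_square algebra_simps)
    then have "A = 2 * ?z\<^sup>2 - 1"
      unfolding A zw(2,3) dw dv by (simp add: algebra_simps)
    moreover have "?z * ?w = z\<^sup>2 * B * v' + z * w * B\<^sup>2 + z * w * (d * v'\<^sup>2) + B * v' * (d * w\<^sup>2)"
      by (simp add: power2_eq_square algebra_simps)
    then have "u = 2 * ?z * ?w"
      unfolding u zw(2,3) dw dv mult.assoc[of 2] by (simp add: algebra_simps)
    ultimately show ?thesis by blast
  qed
qed

section \<open>Even exponents\<close>

text \<open>
  The greatest common divisor serves as \<open>d\<close>: the cofactors are coprime and their product is still
  a square, so each of them is one.
\<close>

lemma product_square_imp_common_factor:
  fixes P Q x :: int
  assumes "P > 0" "Q > 0" "P * Q = x\<^sup>2"
  obtains d u v where "d > 0" "P = d * u\<^sup>2" "Q = d * v\<^sup>2"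
proof -
  define g a b where "g = gcd (nat P) (nat Q)" and "a = nat P div g" and "b = nat Q div g"
  have "g > 0" using assms by (simp add: g_def)
  have P: "nat P = g * a" and Q: "nat Q = g * b"
    by (simp_all add: a_def b_def g_def)
  have pos: "a > 0" "b > 0"
    using P Q assms by (auto intro: Nat.gr0I)
  have "coprime a b"
    using assms unfolding a_def b_def g_def by (intro div_gcd_coprime) auto
  have "g\<^sup>2 * (a * b) = nat P * nat Q"
    unfolding P Q by (simp add: power2_eq_square)
  also have "\<dots> = (nat \<bar>x\<bar>)\<^sup>2"
    using assms by (simp flip: nat_mult_distrib nat_power_eq)
  finally have eq: "g\<^sup>2 * (a * b) = (nat \<bar>x\<bar>)\<^sup>2" .
  then have "g dvd nat \<bar>x\<bar>"
    by (metis dvd_triv_left pow_divides_pow_iff zero_less_numeral)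
  then obtain y where "nat \<bar>x\<bar> = g * y" ..
  with eq \<open>g > 0\<close> have "a * b = y\<^sup>2"
    by (simp add: power_mult_distrib)
  then have "is_nth_power (2::nat) (a * b)" by (auto simp: is_nth_power_def)
  from is_nth_power_mult_coprime_natD[OF \<open>coprime a b\<close> this pos]
  obtain u v where "a = u\<^sup>2" "b = v\<^sup>2" by (auto simp: is_nth_power_def)
  with P Q assms have "P = int g * (int u)\<^sup>2" "Q = int g * (int v)\<^sup>2"
    by (metis int_nat_eq of_nat_mult of_nat_power less_imp_le)+
  with \<open>g > 0\<close> show ?thesis using that[of "int g" "int u" "int v"] by simp
qed

lemma two_nonresidue_mod_13:
  fixes z :: int
  shows "(2 * z\<^sup>2) mod 13 \<noteq> 1"
proof -
  have "z mod 13 \<in> set [0..12]" by simp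
  moreover have "\<forall>r\<in>set [0..12::int]. (2 * r\<^sup>2) mod 13 \<noteq> 1" by code_simp
  ultimately have "(2 * (z mod 13)\<^sup>2) mod 13 \<noteq> 1" by blast
  then show ?thesis by (metis mod_mult_right_eq power_mod)
qed

lemma no_even_exponent:
  fixes m :: nat and x :: int
  assumes "m > 0"
  shows "(13 ^ (2 * m) - 1) * (76 ^ (2 * m) - 1) \<noteq> x\<^sup>2"
proof
  assume eq: "(13 ^ (2 * m) - 1) * (76 ^ (2 * m) - 1) = x\<^sup>2"
  define A B :: int where "A = 13 ^ m" and "B = 76 ^ m"
  have "A > 1" "B > 1"
    using assms unfolding A_def B_def by (simp_all add: one_less_power)
  then have "A\<^sup>2 > 1" "B\<^sup>2 > 1" by (simp_all add: one_less_power)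
  moreover have "(A\<^sup>2 - 1) * (B\<^sup>2 - 1) = x\<^sup>2"
    using eq by (simp add: A_def B_def mult.commute flip: power_mult)
  ultimately obtain d u v where "d > 0" "A\<^sup>2 - 1 = d * u\<^sup>2" "B\<^sup>2 - 1 = d * v\<^sup>2"
    using product_square_imp_common_factor[of "A\<^sup>2 - 1" "B\<^sup>2 - 1" x] by auto
  then have "A\<^sup>2 = d * u\<^sup>2 + 1" "B\<^sup>2 = d * v\<^sup>2 + 1" by simp_all
  moreover have "odd A" "even B" using assms by (simp_all add: A_def B_def)
  ultimately obtain z where "A = 2 * z\<^sup>2 - 1"
    using pell_odd_imp_square[of A d u B v] \<open>d > 0\<close> \<open>A > 1\<close> \<open>B > 1\<close> by auto
  moreover have "13 dvd A" using assms by (simp add: A_def)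
  ultimately have "(2 * z\<^sup>2) mod 13 = 1" by presburger
  with two_nonresidue_mod_13 show False by blast
qed

section \<open>Odd exponents\<close>

lemma power_mod_period:
  fixes a M :: int
  assumes "a ^ 8 mod M = 1 mod M"
  shows "a ^ n mod M = a ^ (n mod 8) mod M"
proof -
  have "a ^ n = (a ^ 8) ^ (n div 8) * a ^ (n mod 8)"
    by (simp flip: power_mult power_add)
  also have "\<dots> mod M = (1 ^ (n div 8) * a ^ (n mod 8)) mod M"
    using assms by (metis mod_mult_left_eq power_mod)
  finally show ?thesis by simp
qed

lemma one_minus_13_power_square_mod_32:
  fixes n :: nat and x :: int
  assumes "odd n" "x\<^sup>2 mod 32 = (1 - 13 ^ n) mod 32"
  shows "n mod 8 = 5"
proof -
  have x: "x mod 32 \<in> set [0..31]" by simp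
  have n: "n mod 8 \<in> {1, 3, 5, 7}"
    using \<open>odd n\<close> by (simp, presburger)
  have "(x mod 32)\<^sup>2 mod 32 = x\<^sup>2 mod 32" by (rule power_mod)
  also have "\<dots> = (1 - 13 ^ n mod 32) mod 32"
    using assms by (simp add: mod_diff_right_eq)
  also have "\<dots> = (1 - 13 ^ (n mod 8) mod 32) mod 32"
    by (subst power_mod_period) simp_all
  finally have "(x mod 32)\<^sup>2 mod 32 = (1 - 13 ^ (n mod 8) mod 32) mod 32" .
  moreover have "\<forall>r\<in>set [0..31::int]. \<forall>k\<in>{1, 3, 5, 7::nat}.
      r\<^sup>2 mod 32 = (1 - 13 ^ k mod 32) mod 32 \<longrightarrow> k = 5"
    by code_simp
  ultimately show ?thesis using x n by blast
qed

lemma square_mod_17_neq_11: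
  fixes x :: int
  shows "x\<^sup>2 mod 17 \<noteq> 11"
proof -
  have "x mod 17 \<in> set [0..16]" by simp
  moreover have "\<forall>r\<in>set [0..16::int]. r\<^sup>2 mod 17 \<noteq> 11" by code_simp
  ultimately have "(x mod 17)\<^sup>2 mod 17 \<noteq> 11" by blast
  then show ?thesis by (simp add: power_mod)
qed

lemma odd_exponent_eq_1:
  fixes n :: nat and x :: int
  assumes "odd n" and eq: "(13 ^ n - 1) * (76 ^ n - 1) = x\<^sup>2"
  shows "n = 1"
proof (rule ccontr)
  assume "n \<noteq> 1"
  with \<open>odd n\<close> have "n \<ge> 3" by presburger
  then have "(76::int) ^ 3 dvd 76 ^ n" by (rule le_imp_power_dvd)
  then have "(32::int) dvd 76 ^ n"
    by (rule dvd_trans[rotated]) simp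
  then obtain k :: int where k: "76 ^ n = 32 * k" ..
  have "x\<^sup>2 = (1 - 13 ^ n) + 32 * ((13 ^ n - 1) * k)"
    unfolding eq[symmetric] k by (simp add: algebra_simps)
  then have "x\<^sup>2 mod 32 = (1 - 13 ^ n) mod 32" by simp
  with \<open>odd n\<close> have n: "n mod 8 = 5" by (rule one_minus_13_power_square_mod_32)
  have "(13::int) ^ n mod 17 = 13" "(76::int) ^ n mod 17 = 9"
    by (subst power_mod_period; simp add: n)+
  then have "((13 ^ n - 1) * (76 ^ n - 1)) mod 17 = ((13 - 1) * (9 - 1)) mod (17::int)"
    by (intro mod_mult_cong mod_diff_cong) simp_all
  then have "x\<^sup>2 mod 17 = 11" by (simp add: eq)
  with square_mod_17_neq_11 show False by blast
qed

theorem corollary10: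
  fixes n :: nat and x :: int
  shows "n > 0 \<and> x > 0 \<and> (13 ^ n - 1) * (76 ^ n - 1) = x ^ 2 \<longleftrightarrow> n = 1 \<and> x = 30"
proof
  assume "n > 0 \<and> x > 0 \<and> (13 ^ n - 1) * (76 ^ n - 1) = x ^ 2"
  then have "n > 0" "x > 0" and eq: "(13 ^ n - 1) * (76 ^ n - 1) = x ^ 2" by auto
  have "odd n"
  proof
    assume "even n"
    then obtain m where "n = 2 * m" ..
    with \<open>n > 0\<close> eq no_even_exponent[of m x] show False by simp
  qed
  then have "n = 1" using eq by (rule odd_exponent_eq_1)
  with eq have "x\<^sup>2 = 30\<^sup>2" by simp
  with \<open>x > 0\<close> have "x = 30" by (intro power2_eq_imp_eq[of x 30]) simp_all
  with \<open>n = 1\<close> show "n = 1 \<and> x = 30" ..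
qed simp

end
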